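(* For $i=0,\ldots,n$ let $\mathfrak{p}_i=(x_{jk} : 1\le j\le n-i,\ k\ge 1)\subset\mathbf{A}$. The $\mathbf{P}$-prime ideals of $\mathbf{A}$ are exactly the ideals $\mathfrak{p}_0,\ldots,\mathfrak{p}_n$, and they form a single chain of length $n$ in $\mathbf{A}$: $$0=\mathfrak{p}_n\subsetneq\mathfrak{p}_{n-1}\subsetneq\cdots\subsetneq\mathfrak{p}_0\subsetneq\mathbf{A}.$$
   Context: Fix an integer $n\ge 1$ and work over $\mathbb{C}$. Let $\mathbf{V}$ be the vector space with basis $\{e_{ij} : 1\le i\le n,\ j\ge 1\}$, and let $\mathbf{V}_i$ be the span of the $e_{kj}$ with $k\le i$, giving a flag $0=\mathbf{V}_0\subset\mathbf{V}_1\subset\cdots\subset\mathbf{V}_n=\mathbf{V}$ whose graded pieces are infinite-dimensional. Let $\mathbf{GL}=\bigcup_m \mathrm{GL}_m(\mathbb{C})$ be the group of invertible linear maps of $\mathbf{V}$ whose matrix in this basis differs from the identity in only finitely many entries, and let $\mathbf{P}\subset\mathbf{GL}$ be the subgroup preserving the flag. Let $\mathbf{A}=\operatorname{Sym}(\mathbf{V})=\mathbb{C}[x_{ij} : 1\le i\le n,\ j\ge 1]$, where $x_{ij}$ corresponds to $e_{ij}$, with the induced $\mathbf{P}$-action. A $\mathbf{P}$-ideal of $\mathbf{A}$ is an ideal (in the usual sense) that is stable under $\mathbf{P}$. A proper $\mathbf{P}$-ideal $\mathfrak{p}$ is $\mathbf{P}$-prime if for all $\mathbf{P}$-ideals $\mathfrak{a},\mathfrak{b}$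 with $\mathfrak{a}\mathfrak{b}\subset\mathfrak{p}$, either $\mathfrak{a}\subset\mathfrak{p}$ or $\mathfrak{b}\subset\mathfrak{p}$. *)

theory Defs
  imports
    Complex_Main
    "HOL-Library.Poly_Mapping"
    "HOL-Algebra.Ideal_Product"
    "HOL-Algebra.Bij"
begin

text \<open>
  The basis vector \<open>e\<^sub>i\<^sub>j\<close> and the variable \<open>x\<^sub>i\<^sub>j\<close> are both indexed by the pair \<open>(i, j)\<close>.
  Vectors are finitely supported functions on indices; polynomials are finitely supported
  functions on monomials, with the convolution product of \<^typ>\<open>'a \<Rightarrow>\<^sub>0 'b\<close>.
\<close>

type_synonym index = "nat \<times> nat"
type_synonym vec = "index \<Rightarrow>\<^sub>0 complex"
type_synonym mpoly = "(index \<Rightarrow>\<^sub>0 nat) \<Rightarrow>\<^sub>0 complex"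

definition indices :: "nat \<Rightarrow> index set"
  where "indices i = {1..i} \<times> {1..}"

definition bvec :: "index \<Rightarrow> vec"
  where "bvec a = Poly_Mapping.single a 1"

definition scale :: "complex \<Rightarrow> vec \<Rightarrow> vec"
  where "scale c v = Poly_Mapping.map ((*) c) v"

text \<open>
  \<open>VV n\<close> is the whole space and \<open>VV 0, \<dots>, VV n\<close> is the flag in it: the member \<open>VV i\<close> does not depend
  on \<open>n\<close>.
\<close>

definition VV :: "nat \<Rightarrow> vec set"
  where "VV i = {v. Poly_Mapping.keys v \<subseteq> indices i}"

definition linear_on_VV :: "nat \<Rightarrow> (vec \<Rightarrow> vec) \<Rightarrow> bool"
  where "linear_on_VV n g \<longleftrightarrow>
    (\<forall>u\<in>VV n. \<forall>v\<in>VV n. g (u + v) = g u + g v) \<and>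
    (\<forall>c. \<forall>v\<in>VV n. g (scale c v) = scale c (g v))"

text \<open>
  \<^const>\<open>Bij\<close> consists of the bijections of \<open>VV n\<close> that are \<^const>\<open>undefined\<close> outside \<open>VV n\<close>, so an
  element of \<open>GL n\<close> is determined by its values on \<open>VV n\<close>. The entry of its matrix in row \<open>a\<close> and
  column \<open>b\<close> is \<open>lookup (g (bvec b)) a\<close>.
\<close>

definition GL :: "nat \<Rightarrow> (vec \<Rightarrow> vec) set"
  where "GL n = {g \<in> Bij (VV n). linear_on_VV n g \<and>
    finite {(a, b) \<in> indices n \<times> indices n.
      Poly_Mapping.lookup (g (bvec b)) a \<noteq> (if a = b then 1 else 0)}}"

definition PP :: "nat \<Rightarrow> (vec \<Rightarrow> vec) set"
  where "PP n = {g \<in> GL n. \<forall>i\<le>n. g ` VV i = VV i}"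

definition const_poly :: "complex \<Rightarrow> mpoly"
  where "const_poly c = Poly_Mapping.single 0 c"

definition xvar :: "index \<Rightarrow> mpoly"
  where "xvar a = Poly_Mapping.single (Poly_Mapping.single a 1) 1"

definition AA :: "nat \<Rightarrow> mpoly ring"
  where "AA n = \<lparr>
    carrier = {f. \<forall>m\<in>Poly_Mapping.keys f. Poly_Mapping.keys m \<subseteq> indices n},
    mult = (*), one = 1, zero = 0, add = (+)\<rparr>"

text \<open>
  \<open>linear_form\<close> is the inclusion of \<open>VV n\<close> into its symmetric algebra \<open>AA n\<close>, sending \<open>bvec a\<close> to \<open>xvar a\<close>.
  The action of \<open>g\<close> on the symmetric algebra is the algebra homomorphism extending
  \<open>g\<close>, that is, the substitution of \<open>linear_form (g (bvec a))\<close> for each variable \<open>xvar a\<close>.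
\<close>

definition linear_form :: "vec \<Rightarrow> mpoly"
  where "linear_form v = (\<Sum>a\<in>Poly_Mapping.keys v. const_poly (Poly_Mapping.lookup v a) * xvar a)"

definition act :: "(vec \<Rightarrow> vec) \<Rightarrow> mpoly \<Rightarrow> mpoly"
  where "act g f = (\<Sum>m\<in>Poly_Mapping.keys f. const_poly (Poly_Mapping.lookup f m) *
    (\<Prod>a\<in>Poly_Mapping.keys m. linear_form (g (bvec a)) ^ Poly_Mapping.lookup m a))"

definition P_ideal :: "nat \<Rightarrow> mpoly set \<Rightarrow> bool"
  where "P_ideal n I \<longleftrightarrow> ideal I (AA n) \<and> (\<forall>g\<in>PP n. act g ` I \<subseteq> I)"

definition P_prime :: "nat \<Rightarrow> mpoly set \<Rightarrow> bool"
  where "P_prime n I \<longleftrightarrow> P_ideal n I \<and> I \<noteq> carrier (AA n) \<and>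
    (\<forall>a b. P_ideal n a \<longrightarrow> P_ideal n b \<longrightarrow> ideal_prod (AA n) a b \<subseteq> I \<longrightarrow> a \<subseteq> I \<or> b \<subseteq> I)"

definition \<pp> :: "nat \<Rightarrow> nat \<Rightarrow> mpoly set"
  where "\<pp> n i = genideal (AA n) {xvar (j, k) |j k. 1 \<le> j \<and> j \<le> n - i \<and> 1 \<le> k}"

end

theory Submission
  imports Defs
begin

text \<open>
  Scaling single coordinates shows that every \<open>P\<close>-ideal is spanned by monomials. The transvections
  \<open>x\<^sub>a \<mapsto> x\<^sub>a + x\<^sub>b\<close> then show that in such a monomial any factor \<open>x\<^sub>a\<close> may be replaced by \<open>x\<^sub>b\<close>, as long
  as the row of \<open>b\<close> is at most the row of \<open>a\<close>. For a \<open>P\<close>-prime \<open>I\<close> let \<open>s\<close> be maximal such that the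
  ideal generated by the first \<open>s\<close> rows of variables lies in \<open>I\<close>. If \<open>I\<close> were larger than this ideal, it
  would contain a monomial, of degree \<open>d\<close> say, in the rows beyond \<open>s\<close>, hence by replacement
  the \<open>d\<close>-th power of the ideal generated by the first \<open>s + 1\<close> rows. Primality contradicts the choice of \<open>s\<close>.
\<close>

section \<open>Finitely supported functions: coefficients, monomials, sums and products\<close>

abbreviation "keys \<equiv> Poly_Mapping.keys"
abbreviation "lookup \<equiv> Poly_Mapping.lookup"
abbreviation "single \<equiv> Poly_Mapping.single"

abbreviation monomial :: "(index \<Rightarrow>\<^sub>0 nat) \<Rightarrow> mpoly"
  where "monomial m \<equiv> single m 1"

lemma lookup_scale [simp]: "lookup (scale c v) a = c * lookup v a"
  by (simp add: scale_def Poly_Mapping.map.rep_eq when_def)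

lemma lookup_const_poly_mult [simp]: "lookup (const_poly c * f) m = c * lookup f m"
proof -
  have "lookup (const_poly c * f) m =
      (\<Sum>l. c * (\<Sum>q. lookup f q when m = l + q) when 0 = l)"
    by (simp add: const_poly_def lookup_mult lookup_single when_mult)
  then show ?thesis by simp
qed

lemma sum_single_lookup: "(\<Sum>a\<in>keys p. single a (lookup p a)) = p"
  by (rule poly_mapping_eqI) (simp add: lookup_sum lookup_single when_def in_keys_iff)

lemma sum_monomials: "(\<Sum>m\<in>keys f. const_poly (lookup f m) * monomial m) = f"
  using sum_single_lookup[of f] by (simp add: const_poly_def mult_single)

lemma prod_single:
  fixes c :: "'a \<Rightarrow> 'c::comm_semiring_1" and h :: "'a \<Rightarrow> 'b::comm_monoid_add"
  shows "finite A \<Longrightarrow> (\<Prod>a\<in>A. single (h a) (c a)) = single (\<Sum>a\<in>A. h a) (\<Prod>a\<in>A. c a)"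
  by (induction A rule: finite_induct) (simp_all add: mult_single)

lemma single_power: "single (single a 1) c ^ k = single (single a k) (c ^ k)"
  for c :: complex and a :: index
  by (induction k) (simp_all add: mult_single single_add[symmetric])

section \<open>The polynomial ring and its ideals\<close>

lemma carrier_AA: "f \<in> carrier (AA n) \<longleftrightarrow> (\<forall>m\<in>keys f. keys m \<subseteq> indices n)"
  by (simp add: AA_def)

lemma AA_simps [simp]:
  "mult (AA n) = (*)" "one (AA n) = 1" "zero (AA n) = 0" "add (AA n) = (+)"
  by (simp_all add: AA_def)

lemma AA_add_closed: "f \<in> carrier (AA n) \<Longrightarrow> g \<in> carrier (AA n) \<Longrightarrow> f + g \<in> carrier (AA n)"
  using Poly_Mapping.keys_add[of f g] by (auto simp: carrier_AA)

lemma AA_mult_closed: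
  assumes f: "f \<in> carrier (AA n)" and g: "g \<in> carrier (AA n)"
  shows "f * g \<in> carrier (AA n)"
  unfolding carrier_AA
proof
  fix m assume "m \<in> keys (f * g)"
  then obtain p q where "m = p + q" "p \<in> keys f" "q \<in> keys g"
    using keys_mult[of f g] by blast
  then show "keys m \<subseteq> indices n"
    using f g Poly_Mapping.keys_add[of p q] unfolding carrier_AA by blast
qed

lemma const_poly_closed: "const_poly c \<in> carrier (AA n)"
  by (simp add: carrier_AA const_poly_def)

lemma const_poly_minus_one: "const_poly (- 1) * f = - f"
  by (rule poly_mapping_eqI) simp

lemma AA_uminus_closed: "f \<in> carrier (AA n) \<Longrightarrow> - f \<in> carrier (AA n)"
  using AA_mult_closed[OF const_poly_closed] const_poly_minus_one by metis

lemma ring_AA: "ring (AA n)"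
proof -
  have "abelian_group (AA n)"
  proof (rule abelian_groupI)
    fix f assume "f \<in> carrier (AA n)"
    then show "\<exists>g\<in>carrier (AA n). g \<oplus>\<^bsub>AA n\<^esub> f = \<zero>\<^bsub>AA n\<^esub>"
      by (intro bexI[of _ "- f"]) (simp_all add: AA_uminus_closed)
  qed (simp_all add: AA_add_closed algebra_simps, simp add: carrier_AA)
  moreover have "Group.monoid (AA n)"
    by (rule monoidI) (simp_all add: AA_mult_closed algebra_simps, simp add: carrier_AA)
  ultimately show ?thesis
    by (rule ringI) (simp_all add: algebra_simps)
qed

text \<open>Negation is multiplication by the constant \<open>- 1\<close> and the ring is
  commutative, so one-sided absorption already gives an ideal. Ideals can then be handled with plain
  \<open>+\<close> and \<open>*\<close>.\<close>

lemma ideal_AA_iff: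
  "ideal I (AA n) \<longleftrightarrow> I \<subseteq> carrier (AA n) \<and> 0 \<in> I \<and> (\<forall>f\<in>I. \<forall>g\<in>I. f + g \<in> I) \<and>
    (\<forall>f\<in>I. \<forall>h\<in>carrier (AA n). h * f \<in> I)" (is "_ \<longleftrightarrow> ?R")
proof
  assume "ideal I (AA n)"
  then interpret ideal I "AA n" .
  show ?R
    using a_subset I_l_closed additive_subgroup.zero_closed[OF additive_subgroup_axioms]
      additive_subgroup.a_closed[OF additive_subgroup_axioms] by auto
next
  interpret ring "AA n" by (rule ring_AA)
  assume R: ?R
  have "subgroup I (add_monoid (AA n))"
  proof (rule add.subgroupI)
    fix f assume f: "f \<in> I"
    with R have "f \<in> carrier (AA n)" by blast
    then have "\<ominus>\<^bsub>AA n\<^esub> f = - f"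
      by (intro minus_equality) (simp_all add: AA_uminus_closed)
    moreover have "- f \<in> I"
      using R f const_poly_closed const_poly_minus_one by metis
    ultimately show "\<ominus>\<^bsub>AA n\<^esub> f \<in> I" by simp
  qed (use R in auto)
  then show "ideal I (AA n)"
    using R by (intro idealI[OF ring_AA]) (auto simp: mult.commute)
qed

lemma
  assumes "ideal I (AA n)"
  shows ideal_subset: "I \<subseteq> carrier (AA n)"
    and ideal_0: "0 \<in> I"
    and ideal_add: "\<And>f g. f \<in> I \<Longrightarrow> g \<in> I \<Longrightarrow> f + g \<in> I"
    and ideal_mult: "\<And>f h. f \<in> I \<Longrightarrow> h \<in> carrier (AA n) \<Longrightarrow> h * f \<in> I"
    and ideal_const_mult: "\<And>c f. f \<in> I \<Longrightarrow> const_poly c * f \<in> I"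
  using assms const_poly_closed by (auto simp: ideal_AA_iff)

lemma ideal_memI:
  assumes I: "ideal I (AA n)" and f: "\<And>m. m \<in> keys f \<Longrightarrow> monomial m \<in> I"
  shows "f \<in> I"
proof -
  have "(\<Sum>m\<in>K. const_poly (lookup f m) * monomial m) \<in> I"
    if "finite K" "K \<subseteq> keys f" for K
    using that
    by (induction K rule: finite_induct)
       (auto simp: ideal_0[OF I] f intro!: ideal_add[OF I] ideal_const_mult[OF I])
  from this[of "keys f"] show ?thesis by (simp add: sum_monomials)
qed

lemma monomial_ideal_add:
  assumes I: "ideal I (AA n)" and "monomial m \<in> I" "keys q \<subseteq> indices n"
  shows "monomial (q + m) \<in> I"
  using ideal_mult[OF I assms(2), of "monomial q"] assms(3)
  by (simp add: carrier_AA mult_single)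

section \<open>Degree in the first rows\<close>

text \<open>For monomials of \<open>AA n\<close>, taking \<open>s = n\<close> gives the total
  degree.\<close>

definition rowdeg :: "nat \<Rightarrow> (index \<Rightarrow>\<^sub>0 nat) \<Rightarrow> nat"
  where "rowdeg s m = (\<Sum>a\<in>keys m. lookup m a * of_bool (fst a \<le> s))"

text \<open>Gives \<open>p\<close>, \<open>q\<close> and \<open>p + q\<close> one common index set,
  from which additivity of the degree is immediate.\<close>

lemma rowdeg_superset:
  "finite A \<Longrightarrow> keys m \<subseteq> A \<Longrightarrow> rowdeg s m = (\<Sum>a\<in>A. lookup m a * of_bool (fst a \<le> s))"
  unfolding rowdeg_def by (rule sum.mono_neutral_left) (auto simp: in_keys_iff)

lemma rowdeg_add: "rowdeg s (p + q) = rowdeg s p + rowdeg s q"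
proof -
  have "keys (p + q) \<subseteq> keys p \<union> keys q" by (rule Poly_Mapping.keys_add)
  then show ?thesis
    by (simp only: rowdeg_superset[of "keys p \<union> keys q"] finite_keys finite_UnI Un_upper1 Un_upper2
        lookup_add distrib_right sum.distrib)
qed

lemma rowdeg_zero [simp]: "rowdeg s 0 = 0"
  by (simp add: rowdeg_def)

lemma rowdeg_single: "rowdeg s (single a k) = k * of_bool (fst a \<le> s)"
  by (simp add: rowdeg_def)

lemma rowdeg_eq_0_iff: "rowdeg s m = 0 \<longleftrightarrow> (\<forall>a\<in>keys m. s < fst a)"
proof -
  have "rowdeg s m = 0 \<longleftrightarrow> (\<forall>a\<in>keys m. lookup m a * of_bool (fst a \<le> s) = 0)"
    unfolding rowdeg_def by (rule sum_eq_0_iff) simp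
  also have "\<dots> \<longleftrightarrow> (\<forall>a\<in>keys m. s < fst a)"
    by (rule ball_cong[OF refl]) (simp add: in_keys_iff not_le)
  finally show ?thesis .
qed

section \<open>Splitting off a variable, and the filtration by row degree\<close>

lemma split_exponent:
  fixes m :: "'a \<Rightarrow>\<^sub>0 nat"
  assumes "a \<in> keys m"
  obtains m' where "m = single a 1 + m'" "keys m' \<subseteq> keys m"
proof
  show "m = single a 1 + (m - single a 1)"
    using assms
    by (intro poly_mapping_eqI)
       (auto simp: lookup_add lookup_minus lookup_single when_def in_keys_iff)
  show "keys (m - single a 1) \<subseteq> keys m"
    by (auto simp: lookup_minus in_keys_iff)
qed

text \<open>This is the \<open>k\<close>-th power of the ideal generated by the variables in rows at
  most \<open>s\<close>, described through its monomials so that membership can be read off the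
  support.\<close>

definition filt :: "nat \<Rightarrow> nat \<Rightarrow> nat \<Rightarrow> mpoly set"
  where "filt n s k = {f \<in> carrier (AA n). \<forall>m\<in>keys f. k \<le> rowdeg s m}"

lemma filt_0 [simp]: "filt n s 0 = carrier (AA n)"
  by (simp add: filt_def)

lemma filt_subset_carrier: "filt n s k \<subseteq> carrier (AA n)"
  by (auto simp: filt_def)

lemma zero_in_filt: "0 \<in> filt n s k"
  by (simp add: filt_def carrier_AA)

lemma filt_add: "f \<in> filt n s k \<Longrightarrow> g \<in> filt n s k \<Longrightarrow> f + g \<in> filt n s k"
  using Poly_Mapping.keys_add[of f g] by (auto simp: filt_def AA_add_closed)

lemma filt_mult:
  assumes "f \<in> filt n s j" "g \<in> filt n s k" shows "f * g \<in> filt n s (j + k)"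
proof -
  have "j + k \<le> rowdeg s m" if m: "m \<in> keys (f * g)" for m
  proof -
    obtain p q where "m = p + q" "p \<in> keys f" "q \<in> keys g"
      using m keys_mult[of f g] by blast
    then show ?thesis using assms by (auto simp: filt_def rowdeg_add intro: add_mono)
  qed
  then show ?thesis using assms by (auto simp: filt_def AA_mult_closed)
qed

lemma filt_sum: "(\<And>a. a \<in> A \<Longrightarrow> f a \<in> filt n s k) \<Longrightarrow> (\<Sum>a\<in>A. f a) \<in> filt n s k"
  by (induction A rule: infinite_finite_induct) (auto simp: zero_in_filt filt_add)

lemma one_in_filt: "1 \<in> filt n s 0"
  by (simp add: carrier_AA)

lemma filt_prod:
  "(\<And>a. a \<in> A \<Longrightarrow> f a \<in> filt n s (k a)) \<Longrightarrow> (\<Prod>a\<in>A. f a) \<in> filt n s (\<Sum>a\<in>A. k a)"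
  using one_in_filt
  by (induction A rule: infinite_finite_induct) (auto simp: filt_mult simp del: filt_0)

lemma filt_power: "f \<in> filt n s k \<Longrightarrow> f ^ j \<in> filt n s (j * k)"
  using one_in_filt by (induction j) (auto simp: filt_mult simp del: filt_0)

lemma const_mult_filt: "f \<in> filt n s k \<Longrightarrow> const_poly c * f \<in> filt n s k"
  using filt_mult[of "const_poly c" n s 0 f k] const_poly_closed by simp

lemma filt_antimono: "j \<le> k \<Longrightarrow> filt n s k \<subseteq> filt n s j"
  by (auto simp: filt_def)

lemma ideal_filt: "ideal (filt n s k) (AA n)"
  using filt_mult[of _ n s 0 _ k]
  by (auto simp: ideal_AA_iff filt_subset_carrier[THEN subsetD] zero_in_filt filt_add)

section \<open>The action\<close>

lemma bvec_in_VV: "bvec a \<in> VV i \<longleftrightarrow> a \<in> indices i"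
  by (simp add: bvec_def VV_def)

lemma indices_mono: "i \<le> n \<Longrightarrow> indices i \<subseteq> indices n"
  by (auto simp: indices_def)

text \<open>If \<open>i\<close> is at most \<open>s\<close>, every variable that occurs lies in the
  counted rows and contributes degree 1; otherwise the bound is 0 and only membership in the ring is
  claimed.\<close>

lemma linear_form_filt:
  assumes "v \<in> VV i" "i \<le> n"
  shows "linear_form v \<in> filt n s (of_bool (i \<le> s))"
proof -
  have "xvar a \<in> filt n s (of_bool (i \<le> s))" if "a \<in> keys v" for a
    using that assms indices_mono[OF assms(2)]
    by (auto simp: VV_def filt_def carrier_AA xvar_def rowdeg_single indices_def)
  then show ?thesis
    unfolding linear_form_def by (intro filt_sum const_mult_filt)
qed

text \<open>The flag condition sends a variable to a linear form in rows no later than its own, so a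
  factor counted by \<open>rowdeg s\<close> is replaced by a form all of whose terms are counted.
  The filtration is multiplicative, hence whole monomials do not drop in degree.\<close>

lemma act_filt:
  assumes g: "g \<in> PP n" and f: "f \<in> filt n s k"
  shows "act g f \<in> filt n s k"
proof -
  have "(\<Prod>a\<in>keys m. linear_form (g (bvec a)) ^ lookup m a) \<in> filt n s k" if m: "m \<in> keys f" for m
  proof -
    have "linear_form (g (bvec a)) \<in> filt n s (of_bool (fst a \<le> s))" if "a \<in> keys m" for a
    proof (rule linear_form_filt)
      have "a \<in> indices n" using that m f by (auto simp: filt_def carrier_AA)
      then have "fst a \<le> n" "bvec a \<in> VV (fst a)"
        by (auto simp: bvec_in_VV indices_def)
      then show "fst a \<le> n" and "g (bvec a) \<in> VV (fst a)"
        using g unfolding PP_def by blast+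
    qed
    then have "(\<Prod>a\<in>keys m. linear_form (g (bvec a)) ^ lookup m a) \<in> filt n s (rowdeg s m)"
      unfolding rowdeg_def by (intro filt_prod filt_power)
    moreover have "k \<le> rowdeg s m" using f m by (simp add: filt_def)
    ultimately show ?thesis using filt_antimono by blast
  qed
  then show ?thesis
    unfolding act_def by (intro filt_sum const_mult_filt)
qed

lemma P_ideal_filt: "P_ideal n (filt n s k)"
  using act_filt ideal_filt by (auto simp: P_ideal_def)

lemma xvar_eq: "xvar a = monomial (single a 1)"
  by (simp add: xvar_def)

text \<open>A monomial of positive row degree contains a variable from the first
  \<open>n - i\<close> rows, so it is a multiple of a generator.\<close>

lemma pp_eq_filt: "\<pp> n i = filt n (n - i) 1"
proof
  interpret ring "AA n" by (rule ring_AA)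
  let ?S = "{xvar (j, k) |j k. 1 \<le> j \<and> j \<le> n - i \<and> 1 \<le> k}"
  have S: "?S \<subseteq> filt n (n - i) 1"
    by (auto simp: filt_def carrier_AA xvar_def rowdeg_single indices_def)
  then have S': "?S \<subseteq> carrier (AA n)"
    using filt_subset_carrier by blast
  show "\<pp> n i \<subseteq> filt n (n - i) 1"
    unfolding \<pp>_def by (intro genideal_minimal ideal_filt S)
  have I: "ideal (\<pp> n i) (AA n)"
    unfolding \<pp>_def by (intro genideal_ideal S')
  show "filt n (n - i) 1 \<subseteq> \<pp> n i"
  proof
    fix f assume f: "f \<in> filt n (n - i) 1"
    show "f \<in> \<pp> n i"
    proof (rule ideal_memI[OF I])
      fix m assume m: "m \<in> keys f"
      then have "rowdeg (n - i) m \<noteq> 0" and mn: "keys m \<subseteq> indices n"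
        using f by (force simp: filt_def carrier_AA)+
      then obtain a where a: "a \<in> keys m" "fst a \<le> n - i"
        by (auto simp: rowdeg_eq_0_iff not_less)
      obtain m' where m': "m = single a 1 + m'" "keys m' \<subseteq> keys m"
        using split_exponent[OF a(1)] .
      have "xvar a \<in> ?S"
        using a mn by (cases a) (force simp: indices_def)
      then have "monomial (single a 1) \<in> \<pp> n i"
        using genideal_self[OF S'] unfolding \<pp>_def xvar_eq by blast
      then have "monomial (m' + single a 1) \<in> \<pp> n i"
        using m' mn by (intro monomial_ideal_add[OF I]) auto
      then show "monomial m \<in> \<pp> n i"
        using m' by (simp add: add.commute)
    qed
  qed
qed

section \<open>Elementary elements of the parabolic group\<close>

text \<open>For \<open>a \<noteq> b\<close> this is a transvection, and for \<open>a = b\<close> it scales one coordinate by \<open>1 + c\<close>.\<close>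

definition elementary :: "nat \<Rightarrow> index \<Rightarrow> index \<Rightarrow> complex \<Rightarrow> vec \<Rightarrow> vec"
  where "elementary n a b c = (\<lambda>v\<in>VV n. v + single b (c * lookup v a))"

text \<open>A vector of \<open>VV i\<close> with nonzero coordinate at \<open>a\<close> forces the
  row of \<open>a\<close>, hence that of \<open>b\<close>, to be at most \<open>i\<close>; otherwise
  nothing is added.\<close>

lemma elementary_VV:
  assumes "i \<le> n" "b \<in> indices n" "fst b \<le> fst a" "v \<in> VV i"
  shows "elementary n a b c v \<in> VV i"
proof -
  have v: "v \<in> VV n" using assms(1,4) indices_mono by (auto simp: VV_def)
  have "b \<in> indices i" if "lookup v a \<noteq> 0"
    using that assms by (force simp: VV_def indices_def in_keys_iff)
  then have "keys (v + single b (c * lookup v a)) \<subseteq> indices i"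
    using Poly_Mapping.keys_add[of v "single b (c * lookup v a)"] assms(4)
    by (auto simp: VV_def split: if_splits)
  then show ?thesis using v by (simp add: elementary_def VV_def)
qed

text \<open>The equation on \<open>c\<close> and \<open>d\<close> says that the coefficient of the
  composite vanishes: \<open>d = - c\<close> for a transvection, and
  \<open>(1 + c) * (1 + d) = 1\<close> for a scaling.\<close>

lemma elementary_inverse:
  assumes "b \<in> indices n" "fst b \<le> fst a" "v \<in> VV n" "d + c + c * d * of_bool (a = b) = 0"
  shows "elementary n a b d (elementary n a b c v) = v"
proof -
  let ?w = "v + single b (c * lookup v a)"
  have "?w \<in> VV n"
    using elementary_VV[OF _ assms(1,2,3), of c] assms(3) by (simp add: elementary_def)
  then have "elementary n a b d (elementary n a b c v) = ?w + single b (d * lookup ?w a)"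
    using assms(3) by (simp add: elementary_def)
  also have "\<dots> = v + single b ((d + c + c * d * of_bool (a = b)) * lookup v a)"
    by (simp add: lookup_add lookup_single when_def algebra_simps single_add[symmetric])
  finally show ?thesis using assms(4) by simp
qed

lemma elementary_PP:
  assumes a: "a \<in> indices n" and b: "b \<in> indices n" and ab: "fst b \<le> fst a"
    and D: "1 + c * of_bool (a = b) \<noteq> 0"
  shows "elementary n a b c \<in> PP n"
proof -
  let ?g = "elementary n a b c"
  define d where "d = - c / (1 + c * of_bool (a = b))"
  let ?h = "elementary n a b d"
  have d: "d + c + c * d * of_bool (a = b) = 0"
    using D by (simp add: d_def field_simps)
  \<comment> \<open>The condition with \<open>c\<close> and \<open>d\<close> exchanged makes
    \<open>?h\<close> a right inverse as well, which yields surjectivity on every flag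
    member.\<close>
  then have d': "c + d + d * c * of_bool (a = b) = 0"
    by (simp add: algebra_simps)
  have image: "?g ` VV i = VV i" if "i \<le> n" for i
  proof
    show "?g ` VV i \<subseteq> VV i" using elementary_VV[OF that b ab] by blast
    have "v \<in> ?g ` VV i" if v: "v \<in> VV i" for v
    proof
      have "v \<in> VV n" using v \<open>i \<le> n\<close> indices_mono by (auto simp: VV_def)
      then show "v = ?g (?h v)" using elementary_inverse[OF b ab _ d'] by simp
      show "?h v \<in> VV i" using elementary_VV[OF \<open>i \<le> n\<close> b ab v] .
    qed
    then show "VV i \<subseteq> ?g ` VV i" by blast
  qed
  have "inj_on ?g (VV n)"
    by (rule inj_on_inverseI[of _ ?h]) (rule elementary_inverse[OF b ab _ d])
  then have "?g \<in> Bij (VV n)"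
    using image[of n] by (auto simp: Bij_def bij_betw_def elementary_def)
  moreover have "linear_on_VV n ?g"
  proof -
    have "u + v \<in> VV n" if "u \<in> VV n" "v \<in> VV n" for u v
      using that Poly_Mapping.keys_add[of u v] by (auto simp: VV_def)
    moreover have "scale e v \<in> VV n" if "v \<in> VV n" for e v
      using that by (auto simp: VV_def in_keys_iff subset_iff)
    ultimately show ?thesis
      by (auto simp: linear_on_VV_def elementary_def lookup_add algebra_simps single_add
          intro!: poly_mapping_eqI) (auto simp: lookup_add lookup_single when_def algebra_simps)
  qed
  moreover have "finite {(x, y) \<in> indices n \<times> indices n.
      lookup (?g (bvec y)) x \<noteq> (if x = y then 1 else 0)}"
  proof (rule finite_subset)
    \<comment> \<open>The matrix is the identity plus \<open>c\<close> in row \<open>b\<close> and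
      column \<open>a\<close>, so this is the only entry that can deviate.\<close>
    show "{(x, y) \<in> indices n \<times> indices n.
      lookup (?g (bvec y)) x \<noteq> (if x = y then 1 else 0)} \<subseteq> {(b, a)}"
      by (auto simp: elementary_def bvec_in_VV)
         (auto simp: bvec_def lookup_add lookup_single when_def split: if_splits)
  qed simp
  ultimately show ?thesis
    using image by (simp add: PP_def GL_def)
qed

text \<open>Summing over any finite superset of the support avoids deciding which coefficients
  vanish.\<close>

lemma linear_form_superset:
  assumes "finite A" "keys v \<subseteq> A"
  shows "linear_form v = (\<Sum>a\<in>A. single (single a 1) (lookup v a))"
proof -
  have "linear_form v = (\<Sum>a\<in>keys v. single (single a 1) (lookup v a))"
    by (simp add: linear_form_def const_poly_def xvar_def mult_single)
  also have "\<dots> = (\<Sum>a\<in>A. single (single a 1) (lookup v a))"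
    using assms by (intro sum.mono_neutral_left) (auto simp: in_keys_iff)
  finally show ?thesis .
qed

lemma linear_form_elementary_other:
  "x \<in> indices n \<Longrightarrow> x \<noteq> a \<Longrightarrow> linear_form (elementary n a b c (bvec x)) = xvar x"
  by (simp add: elementary_def bvec_in_VV)
     (simp add: bvec_def lookup_single when_def linear_form_superset[of "{x}"] xvar_def)

lemma linear_form_scaling:
  "a \<in> indices n \<Longrightarrow> linear_form (elementary n a a c (bvec a)) = single (single a 1) (1 + c)"
  by (simp add: elementary_def bvec_in_VV)
     (simp add: bvec_def single_add[symmetric] linear_form_superset[of "{a}"])

lemma linear_form_transvection:
  assumes "a \<in> indices n" "a \<noteq> b"
  shows "linear_form (elementary n a b 1 (bvec a)) = xvar a + xvar b"
proof -
  have "elementary n a b 1 (bvec a) = single a 1 + single b 1"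
    using assms by (simp add: elementary_def bvec_in_VV) (simp add: bvec_def)
  moreover have "keys (single a (1::complex) + single b 1) \<subseteq> {a, b}"
    using Poly_Mapping.keys_add[of "single a (1::complex)" "single b 1"] by auto
  ultimately show ?thesis
    using assms(2) linear_form_superset[of "{a, b}" "single a 1 + single b 1"]
    by (simp add: lookup_add lookup_single when_def xvar_def)
qed

section \<open>Ideals stable under the parabolic group\<close>

lemma P_ideal_act: "P_ideal n I \<Longrightarrow> g \<in> PP n \<Longrightarrow> f \<in> I \<Longrightarrow> act g f \<in> I"
  by (auto simp: P_ideal_def)

text \<open>With parameter 1 the map doubles x_a and fixes the other variables, so every monomial is
  an eigenvector whose eigenvalue records its exponent at \<open>a\<close>.\<close>

lemma lookup_act_scaling:
  assumes a: "a \<in> indices n" and f: "f \<in> carrier (AA n)"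
  shows "lookup (act (elementary n a a 1) f) m = 2 ^ lookup m a * lookup f m"
proof -
  let ?g = "elementary n a a 1"
  have prod: "(\<Prod>x\<in>keys p. linear_form (?g (bvec x)) ^ lookup p x) = single p (2 ^ lookup p a)"
    if p: "p \<in> keys f" for p
  proof -
    have "(\<Prod>x\<in>keys p. linear_form (?g (bvec x)) ^ lookup p x)
        = (\<Prod>x\<in>keys p. single (single x (lookup p x)) (if x = a then 2 ^ lookup p a else 1))"
    proof (rule prod.cong[OF refl])
      fix x assume "x \<in> keys p"
      then have "x \<in> indices n" using p f by (auto simp: carrier_AA)
      then show "linear_form (?g (bvec x)) ^ lookup p x
          = single (single x (lookup p x)) (if x = a then 2 ^ lookup p a else 1)"
        using single_power[of x 1 "lookup p x"] single_power[of x 2 "lookup p x"]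
          linear_form_scaling[of x n 1] linear_form_elementary_other[of x n a a 1]
        by (auto simp: xvar_def)
    qed
    also have "\<dots> = single p (\<Prod>x\<in>keys p. if x = a then 2 ^ lookup p a else 1)"
      by (simp only: prod_single finite_keys sum_single_lookup)
    also have "(\<Prod>x\<in>keys p. if x = a then 2 ^ lookup p a else 1) = (2 ^ lookup p a :: complex)"
      by (auto simp: prod.delta in_keys_iff)
    finally show ?thesis .
  qed
  have "act ?g f = (\<Sum>p\<in>keys f. single p (lookup f p * 2 ^ lookup p a))"
    unfolding act_def by (rule sum.cong) (simp_all add: prod const_poly_def mult_single)
  then show ?thesis
    by (simp add: lookup_sum lookup_single when_def in_keys_iff)
qed

text \<open>
  Stability under the scaling by \<open>2\<close> of single coordinates makes a \<open>P\<close>-ideal a monomial ideal: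
  subtracting a multiple of \<open>f\<close> from its image removes a chosen monomial and keeps another one.
\<close>

lemma P_ideal_monomial:
  assumes I: "P_ideal n I"
  shows "f \<in> I \<Longrightarrow> m \<in> keys f \<Longrightarrow> monomial m \<in> I"
proof (induction "card (keys f)" arbitrary: f rule: less_induct)
  case less
  have ideal: "ideal I (AA n)" using I by (simp add: P_ideal_def)
  have f: "f \<in> carrier (AA n)" using less.prems ideal_subset[OF ideal] by blast
  show ?case
  proof (cases "keys f = {m}")
    case True
    then have "f = single m (lookup f m)" using sum_single_lookup[of f] by simp
    then have "const_poly (1 / lookup f m) * f = monomial m"
      using less.prems(2)
      by (metis const_poly_def add_0 in_keys_iff mult_single nonzero_eq_divide_eq)
    then show ?thesis using ideal_const_mult[OF ideal less.prems(1)] by metis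
  next
    case False
    then obtain m' where m': "m' \<in> keys f" "m' \<noteq> m" using less.prems(2) by auto
    then obtain a where a: "lookup m a \<noteq> lookup m' a"
      by (metis poly_mapping_eqI)
    then have "a \<in> keys m \<union> keys m'" by (auto simp: in_keys_iff)
    then have an: "a \<in> indices n" using m' less.prems(2) f by (auto simp: carrier_AA)
    let ?g = "elementary n a a 1"
    define h where "h = act ?g f + const_poly (- (2 ^ lookup m' a)) * f"
    have "?g \<in> PP n" using an by (intro elementary_PP) auto
    then have h: "h \<in> I"
      unfolding h_def
      by (intro ideal_add[OF ideal] ideal_const_mult[OF ideal] P_ideal_act[OF I] less.prems(1))
    have lookup_h: "lookup h p = (2 ^ lookup p a - 2 ^ lookup m' a) * lookup f p" for p
      by (simp add: h_def lookup_add lookup_act_scaling[OF an f] left_diff_distrib)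
    have "keys h \<subseteq> keys f" "m' \<notin> keys h"
      by (auto simp: in_keys_iff lookup_h)
    then have "card (keys h) < card (keys f)"
      using m'(1) by (intro psubset_card_mono) auto
    \<comment> \<open>Distinct exponents give distinct eigenvalues: taking norms reduces this to
      injectivity of the real powers of 2.\<close>
    moreover have "(2::complex) ^ lookup m a \<noteq> 2 ^ lookup m' a"
    proof
      assume "(2::complex) ^ lookup m a = 2 ^ lookup m' a"
      then have "norm ((2::complex) ^ lookup m a) = norm ((2::complex) ^ lookup m' a)" by simp
      then show False using a by (simp add: norm_power)
    qed
    then have "m \<in> keys h" using less.prems(2) by (simp add: in_keys_iff lookup_h)
    ultimately show ?thesis using less.hyps h by blast
  qed
qed

text \<open>All powers of x_a are collected in the first factor, so the transvection fixes
  \<open>r\<close>, which may still contain x_b.\<close>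

lemma act_transvection_monomial:
  assumes a: "a \<in> indices n" and ab: "a \<noteq> b" and r: "keys r \<subseteq> indices n" "lookup r a = 0"
  shows "act (elementary n a b 1) (monomial (single a (Suc k) + r)) =
    (xvar a + xvar b) ^ Suc k * monomial r"
proof -
  let ?g = "elementary n a b 1" and ?m = "single a (Suc k) + r"
  have m: "lookup ?m x = (if x = a then Suc k else lookup r x)" for x
    using r(2) by (simp add: lookup_add lookup_single when_def)
  have keys_m: "keys ?m = insert a (keys r)" and "a \<notin> keys r"
    using r(2) by (simp_all only: set_eq_iff insert_iff in_keys_iff m) auto
  have "act ?g (monomial ?m) = (\<Prod>x\<in>keys ?m. linear_form (?g (bvec x)) ^ lookup ?m x)"
    by (simp add: act_def const_poly_def)
  also have "\<dots> = linear_form (?g (bvec a)) ^ Suc k *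
      (\<Prod>x\<in>keys r. linear_form (?g (bvec x)) ^ lookup ?m x)"
    unfolding keys_m using \<open>a \<notin> keys r\<close> by (simp add: m)
  also have "(\<Prod>x\<in>keys r. linear_form (?g (bvec x)) ^ lookup ?m x) =
      (\<Prod>x\<in>keys r. single (single x (lookup r x)) 1)"
  proof (rule prod.cong[OF refl])
    fix x assume x: "x \<in> keys r"
    then have "x \<noteq> a" using \<open>a \<notin> keys r\<close> by auto
    then show "linear_form (?g (bvec x)) ^ lookup ?m x = single (single x (lookup r x)) 1"
      using x r(1) single_power[of x 1 "lookup r x"] linear_form_elementary_other[of x n a b 1]
      by (auto simp: m xvar_def)
  qed
  also have "\<dots> = monomial r"
    by (simp add: prod_single sum_single_lookup)
  finally show ?thesis using linear_form_transvection[OF a ab] by simp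
qed

text \<open>This is the term \<open>j = k\<close> of the binomial expansion; the other terms have a
  different exponent at \<open>a\<close>. In characteristic zero the coefficient is nonzero.\<close>

lemma lookup_binomial:
  assumes ab: "a \<noteq> b"
  shows "lookup ((xvar a + xvar b) ^ Suc k * monomial r) (single a k + single b 1 + r) = of_nat (Suc k)"
proof -
  have "(xvar a + xvar b) ^ Suc k * monomial r =
      (\<Sum>j\<le>Suc k. single (single a j + single b (Suc k - j) + r) (of_nat (Suc k choose j)))"
    unfolding binomial_ring sum_distrib_right
    by (rule sum.cong[OF refl])
      (simp only: xvar_def single_power mult_single single_of_nat[symmetric] power_one
        mult_1_right add_0)
  moreover have "single a j + single b (Suc k - j) + r = single a k + single b 1 + r \<longleftrightarrow> j = k"
    for j
  proof
    assume "single a j + single b (Suc k - j) + r = single a k + single b 1 + r"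
    then have "lookup (single a j + single b (Suc k - j)) a = lookup (single a k + single b 1) a"
      by (metis add_right_cancel)
    then show "j = k" using ab by (simp add: lookup_add lookup_single)
  qed simp
  ultimately show ?thesis
    by (simp add: lookup_sum lookup_single when_def del: power_Suc sum.atMost_Suc)
qed

text \<open>The transvected monomial has a term in which exactly one factor x_a has become x_b.
  \<open>P_ideal_monomial\<close> extracts this term.\<close>

lemma P_ideal_replace:
  assumes I: "P_ideal n I" and ab: "a \<in> indices n" "b \<in> indices n" "fst b \<le> fst a"
    and m: "monomial (single a 1 + q) \<in> I"
  shows "monomial (single b 1 + q) \<in> I"
proof (cases "a = b")
  case False
  \<comment> \<open>\<open>k\<close> counts the copies of x_a left in \<open>q\<close>, so the full
    monomial has exponent \<open>Suc k\<close> at \<open>a\<close> and \<open>r\<close> is free of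
    x_a.\<close>
  define k where "k = lookup q a"
  define r where "r = q - single a k"
  have q: "q = single a k + r"
    by (rule poly_mapping_eqI)
      (auto simp: r_def k_def lookup_add lookup_minus lookup_single when_def)
  have ra: "lookup r a = 0" by (simp add: r_def k_def lookup_minus)
  have m': "single a 1 + q = single a (Suc k) + r"
    by (simp add: q single_add[symmetric] flip: add.assoc)
  have "keys (single a 1 + q) \<subseteq> indices n"
    using m I ideal_subset[of I n] by (force simp: P_ideal_def carrier_AA)
  moreover have "keys r \<subseteq> keys (single a 1 + q)"
    by (auto simp: q in_keys_iff lookup_add)
  ultimately have r: "keys r \<subseteq> indices n" by blast
  have "elementary n a b 1 \<in> PP n"
    using ab False by (intro elementary_PP) auto
  then have "act (elementary n a b 1) (monomial (single a 1 + q)) \<in> I"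
    using P_ideal_act[OF I] m by blast
  then have "(xvar a + xvar b) ^ Suc k * monomial r \<in> I"
    using act_transvection_monomial[OF ab(1) False r ra] m' by simp
  moreover have "single a k + single b 1 + r \<in> keys ((xvar a + xvar b) ^ Suc k * monomial r)"
    unfolding in_keys_iff lookup_binomial[OF False] of_nat_eq_0_iff by simp
  ultimately have "monomial (single a k + single b 1 + r) \<in> I"
    using P_ideal_monomial[OF I] by blast
  then show ?thesis by (simp add: q ac_simps)
qed (use m in simp)

text \<open>The variables of \<open>m\<close> are traded one by one for variables of
  \<open>u\<close> in rows at most \<open>s\<close>. The row condition on \<open>m\<close> makes
  each trade admissible for \<open>P_ideal_replace\<close>, and the degree bound ensures that
  \<open>u\<close> has enough such variables. What remains of \<open>u\<close> is supplied by
  absorption.\<close>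

lemma P_ideal_exchange:
  assumes I: "P_ideal n I"
  shows "\<lbrakk>monomial (m + q) \<in> I; keys m \<subseteq> indices n; \<forall>a\<in>keys m. s \<le> fst a;
    keys u \<subseteq> indices n; rowdeg n m \<le> rowdeg s u\<rbrakk> \<Longrightarrow> monomial (u + q) \<in> I"
proof (induction "rowdeg n m" arbitrary: m q u)
  case 0
  \<comment> \<open>No index of \<open>indices n\<close> has a row beyond \<open>n\<close>, so total
    degree zero leaves no variable in \<open>m\<close>.\<close>
  then have "n < fst a" "a \<in> indices n" if "a \<in> keys m" for a
    using that rowdeg_eq_0_iff[of n m] by auto
  then have "keys m = {}" by (fastforce simp: indices_def)
  then have "m = 0" using sum_single_lookup[of m] by simp
  with 0 I show ?case using monomial_ideal_add[of I n q u] by (simp add: P_ideal_def)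
next
  case (Suc d)
  then obtain a where a: "a \<in> keys m"
    by (metis nat.distinct(1) rowdeg_eq_0_iff)
  obtain m' where m': "m = single a 1 + m'" "keys m' \<subseteq> keys m"
    using split_exponent[OF a] .
  have "rowdeg s u \<noteq> 0" using Suc by linarith
  then obtain b where b: "b \<in> keys u" "fst b \<le> s"
    by (auto simp: rowdeg_eq_0_iff not_less)
  obtain u' where u': "u = single b 1 + u'" "keys u' \<subseteq> keys u"
    using split_exponent[OF b(1)] .
  have an: "a \<in> indices n" "b \<in> indices n" using a b Suc.prems by auto
  have "monomial (single b 1 + (m' + q)) \<in> I"
  proof (rule P_ideal_replace[OF I an])
    show "fst b \<le> fst a" using Suc.prems(3) a b by fastforce
    show "monomial (single a 1 + (m' + q)) \<in> I"
      using Suc.prems(1) m' by (simp add: ac_simps)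
  qed
  \<comment> \<open>The traded variable joins the passive factor, so that the induction hypothesis
    applies to \<open>m'\<close> and \<open>u'\<close>.\<close>
  then have mI: "monomial (m' + (single b 1 + q)) \<in> I" by (simp add: ac_simps)
  have deg_m:  "rowdeg n m = Suc (rowdeg n m')"
    using an by (auto simp: m'(1) rowdeg_add rowdeg_single indices_def)
  have deg_u: "rowdeg s u = Suc (rowdeg s u')"
    using b by (simp add: u'(1) rowdeg_add rowdeg_single)
  have "monomial (u' + (single b 1 + q)) \<in> I"
  proof (rule Suc.hyps(1)[OF _ mI])
    show "d = rowdeg n m'" "rowdeg n m' \<le> rowdeg s u'"
      using Suc.hyps(2) Suc.prems(5) deg_m deg_u by simp_all
    show "keys m' \<subseteq> indices n" "\<forall>a\<in>keys m'. s \<le> fst a" "keys u' \<subseteq> indices n"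
      using Suc.prems(2-4) m'(2) u'(2) by blast+
  qed
  then show ?case by (simp add: u'(1) ac_simps)
qed

lemma filt_subset_P_ideal:
  assumes I: "P_ideal n I" and m: "monomial m \<in> I" "\<forall>a\<in>keys m. s \<le> fst a"
  shows "filt n s (rowdeg n m) \<subseteq> I"
proof
  have ideal: "ideal I (AA n)" using I by (simp add: P_ideal_def)
  then have mn: "keys m \<subseteq> indices n"
    using ideal_subset m(1) by (fastforce simp: carrier_AA)
  fix f assume f: "f \<in> filt n s (rowdeg n m)"
  show "f \<in> I"
  proof (rule ideal_memI[OF ideal])
    fix u assume "u \<in> keys f"
    then show "monomial u \<in> I"
      using P_ideal_exchange[OF I, of m 0 s u] m mn f by (auto simp: filt_def carrier_AA)
  qed
qed

section \<open>The prime ideals\<close>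

text \<open>Since \<open>filt n s 1\<close> times \<open>filt n s d\<close> lies in
  \<open>filt n s (Suc d)\<close>, primality strips off one factor at a time.\<close>

lemma filt_subset_P_prime:
  assumes I: "P_prime n I"
  shows "filt n s d \<subseteq> I \<Longrightarrow> filt n s 1 \<subseteq> I"
proof (induction d)
  case 0
  then show ?case using filt_subset_carrier by fastforce
next
  case (Suc d)
  have "ideal_prod (AA n) (filt n s 1) (filt n s d) \<subseteq> filt n s (Suc d)"
  proof
    fix f assume "f \<in> ideal_prod (AA n) (filt n s 1) (filt n s d)"
    then show "f \<in> filt n s (Suc d)"
    proof induction
      case (prod f g)
      then show ?case using filt_mult[of f n s 1 g d] by simp
    next
      case (sum f g)
      then show ?case by (simp add: filt_add)
    qed
  qed
  with Suc.prems have "ideal_prod (AA n) (filt n s 1) (filt n s d) \<subseteq> I" by blast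
  then show ?case
    using I P_ideal_filt Suc.IH unfolding P_prime_def by blast
qed

text \<open>A \<open>P\<close>-ideal not inside \<open>filt n s 1\<close> contains a monomial of row
  degree zero, because it is a monomial ideal. The product of two such monomials again has row
  degree zero.\<close>

lemma P_prime_filt: "P_prime n (filt n s 1)"
  unfolding P_prime_def
proof (intro conjI allI impI P_ideal_filt)
  have "1 \<in> carrier (AA n)" "1 \<notin> filt n s 1"
    by (simp_all add: carrier_AA filt_def)
  then show "filt n s 1 \<noteq> carrier (AA n)" by blast
next
  fix A B assume A: "P_ideal n A" and B: "P_ideal n B"
    and AB: "ideal_prod (AA n) A B \<subseteq> filt n s 1"
  have outside: "\<exists>m. monomial m \<in> J \<and> rowdeg s m = 0"
    if J: "P_ideal n J" and "\<not> J \<subseteq> filt n s 1" for J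
  proof -
    obtain f where f: "f \<in> J" "f \<notin> filt n s 1" using \<open>\<not> J \<subseteq> filt n s 1\<close> by blast
    then have "f \<in> carrier (AA n)" using J ideal_subset by (auto simp: P_ideal_def)
    with f(2) obtain m where "m \<in> keys f" "rowdeg s m = 0"
      by (auto simp: filt_def not_less_eq_eq)
    then show ?thesis using P_ideal_monomial[OF J f(1)] by blast
  qed
  show "A \<subseteq> filt n s 1 \<or> B \<subseteq> filt n s 1"
  proof (rule ccontr)
    assume "\<not> ?thesis"
    then obtain p q where p: "monomial p \<in> A" "rowdeg s p = 0"
      and q: "monomial q \<in> B" "rowdeg s q = 0"
      using outside[OF A] outside[OF B] by blast
    have "monomial (p + q) \<in> ideal_prod (AA n) A B"
      using ideal_prod.prod[OF p(1) q(1), of "AA n"] by (simp add: mult_single)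
    then have "monomial (p + q) \<in> filt n s 1" using AB by blast
    then show False using p q by (simp add: filt_def rowdeg_add)
  qed
qed

text \<open>Rows are numbered from 1, so no variable is counted for \<open>s = 0\<close>.\<close>

lemma filt_0_1: "filt n 0 1 = {0}"
proof -
  have "f = 0" if f: "f \<in> filt n 0 1" for f
  proof -
    have "m \<notin> keys f" for m
    proof
      assume m: "m \<in> keys f"
      then have "rowdeg 0 m \<noteq> 0" "keys m \<subseteq> indices n"
        using f by (force simp: filt_def carrier_AA)+
      then show False by (auto simp: rowdeg_eq_0_iff indices_def)
    qed
    then show ?thesis using sum_single_lookup[of f] by (metis all_not_in_conv sum.empty)
  qed
  then show ?thesis using zero_in_filt by blast
qed

lemma P_prime_eq_filt:
  assumes I: "P_prime n I"
  shows "\<exists>s\<le>n. I = filt n s 1"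
proof -
  have PI: "P_ideal n I" using I by (simp add: P_prime_def)
  then have ideal: "ideal I (AA n)" by (simp add: P_ideal_def)
  \<comment> \<open>The zero ideal provides a first candidate, so a maximal \<open>s\<close>
    exists.\<close>
  have "0 \<le> n \<and> filt n 0 1 \<subseteq> I" using filt_0_1 ideal_0[OF ideal] by simp
  then obtain s where s: "s \<le> n" "filt n s 1 \<subseteq> I"
    and max: "\<And>t. t \<le> n \<Longrightarrow> filt n t 1 \<subseteq> I \<Longrightarrow> t \<le> s"
    using ex_has_greatest_nat[of "\<lambda>s. s \<le> n \<and> filt n s 1 \<subseteq> I" 0 "\<lambda>s. s" "Suc n"]
    by (auto simp: less_Suc_eq_le)
  have "I \<subseteq> filt n s 1"
  proof (rule ccontr)
    assume "\<not> ?thesis"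
    then obtain f where f: "f \<in> I" "f \<notin> filt n s 1" by blast
    then have fc: "f \<in> carrier (AA n)" using ideal_subset[OF ideal] by blast
    with f(2) obtain m where m: "m \<in> keys f" "rowdeg s m = 0"
      by (auto simp: filt_def not_less_eq_eq)
    have mI: "monomial m \<in> I" using P_ideal_monomial[OF PI f(1) m(1)] .
    have rows: "\<forall>a\<in>keys m. Suc s \<le> fst a" using m(2) by (auto simp: rowdeg_eq_0_iff)
    note sub = filt_subset_P_ideal[OF PI mI rows]
    show False
    proof (cases "s < n")
      case True
      then show False using max[of "Suc s"] filt_subset_P_prime[OF I sub] by simp
    next
      case False
      \<comment> \<open>Here \<open>s = n\<close>, so \<open>m\<close> has total degree zero and
        \<open>sub\<close> concerns the whole ring, against properness of \<open>I\<close>.\<close>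
      then have "carrier (AA n) \<subseteq> I" using sub m(2) s(1) by simp
      then show False using I ideal_subset[OF ideal] by (auto simp: P_prime_def)
    qed
  qed
  with s show ?thesis by blast
qed

theorem theorem1p1:
  fixes n :: nat
  assumes "n \<ge> 1"
  shows "{I. P_prime n I} = {\<pp> n i |i. i \<le> n} \<and>
    \<pp> n n = {0} \<and>
    (\<forall>i<n. \<pp> n (Suc i) \<subset> \<pp> n i) \<and>
    \<pp> n 0 \<subset> carrier (AA n)"
proof (intro conjI allI impI)
  show "{I. P_prime n I} = {\<pp> n i |i. i \<le> n}"
  proof (intro equalityI subsetI)
    fix I assume "I \<in> {I. P_prime n I}"
    then obtain s where "s \<le> n" "I = filt n s 1" using P_prime_eq_filt by blast
    \<comment> \<open>The numbering is reversed: \<open>s\<close> counts the rows generating the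
      ideal, while the index of \<open>\<pp>\<close> counts the rows left out.\<close>
    then have "n - s \<le> n" "I = \<pp> n (n - s)" by (simp_all add: pp_eq_filt)
    then show "I \<in> {\<pp> n i |i. i \<le> n}" by blast
  qed (auto simp: pp_eq_filt P_prime_filt simp del: One_nat_def)
  show "\<pp> n n = {0}" by (simp add: pp_eq_filt filt_0_1 del: One_nat_def)
  show "\<pp> n 0 \<subset> carrier (AA n)"
    using P_prime_filt[of n n] filt_subset_carrier[of n n 1]
    by (auto simp: pp_eq_filt P_prime_def)
  fix i assume i: "i < n"
  have "filt n (n - Suc i) 1 \<subseteq> filt n (n - i) 1"
  proof -
    have "rowdeg (n - Suc i) m \<le> rowdeg (n - i) m" for m
      unfolding rowdeg_def by (intro sum_mono) auto
    then show ?thesis by (auto simp: filt_def intro: order_trans)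
  qed
  \<comment> \<open>Row \<open>n - i\<close> is the one row counted on the larger side only;
    \<open>i < n\<close> makes it a valid row.\<close>
  moreover have "xvar (n - i, 1) \<in> filt n (n - i) 1" "xvar (n - i, 1) \<notin> filt n (n - Suc i) 1"
    using i by (auto simp: filt_def carrier_AA xvar_def rowdeg_single indices_def)
  ultimately show "\<pp> n (Suc i) \<subset> \<pp> n i" unfolding pp_eq_filt by blast
qed

end
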